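(* Let $a\in C_0^\infty(\mathbb{R}^2)$ and $f\in C_0^\infty(\mathbb{R}^2)$ be radial. Then there exists $f_0\in C_0^\infty(\mathbb{R}^2)$ so that $$X_af=X_0f_0 .$$
   Context: For $x\in\mathbb{R}^2$, $\theta\in S^1$, the attenuated X-ray transform is $X_af(x,\theta)=\int_{\mathbb{R}}e^{-Ba(x+t\theta,\theta)}f(x+t\theta)\,dt$, where $Ba(x,\theta)=\int_0^\infty a(x+t\theta)\,dt$; $X_0$ is the transform with $a=0$, i.e. $X_0f_0(x,\theta)=\int_{\mathbb{R}}f_0(x+t\theta)\,dt$. *)

theory Defs
  imports "HOL-Analysis.Analysis"
begin

text \<open>
  Scalars range over a type of class \<open>{real_normed_field, euclidean_space}\<close>, so that
  \<open>C\<^sub>0\<^sup>\<infinity>(\<real>\<^sup>2)\<close> may consist of real-valued or of complex-valued functions; \<^typ>\<open>real\<close> and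
  \<^typ>\<open>complex\<close> are both instances.
\<close>

text \<open>
  \<open>Ck k f\<close> is \<open>C\<^sup>k\<close> regularity on the whole space. The derivative is taken in an arbitrary
  direction \<open>v\<close>, which keeps the type of the function fixed along the recursion.
\<close>

primrec Ck :: "nat \<Rightarrow> ('a::euclidean_space \<Rightarrow> 'b::real_normed_vector) \<Rightarrow> bool" where
  "Ck 0 f \<longleftrightarrow> continuous_on UNIV f"
| "Ck (Suc k) f \<longleftrightarrow>
     (\<forall>x. f differentiable (at x)) \<and> (\<forall>v. Ck k (\<lambda>x. frechet_derivative f (at x) v))"

definition smooth_compact_support :: "('a::euclidean_space \<Rightarrow> 'b::real_normed_vector) \<Rightarrow> bool" where
  "smooth_compact_support f \<longleftrightarrow> (\<forall>k. Ck k f) \<and> compact (closure {x. f x \<noteq> 0})"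

definition radial :: "('a::real_normed_vector \<Rightarrow> 'b) \<Rightarrow> bool" where
  "radial f \<longleftrightarrow> (\<forall>x y. norm x = norm y \<longrightarrow> f x = f y)"

definition beam :: "(real^2 \<Rightarrow> 'k::{real_normed_field, euclidean_space}) \<Rightarrow> real^2 \<Rightarrow> real^2 \<Rightarrow> 'k" where
  "beam a x \<theta> = (LINT t:{0..}|lborel. a (x + t *\<^sub>R \<theta>))"

definition att_xray ::
  "(real^2 \<Rightarrow> 'k::{real_normed_field, euclidean_space}) \<Rightarrow> (real^2 \<Rightarrow> 'k) \<Rightarrow> real^2 \<Rightarrow> real^2 \<Rightarrow> 'k" where
  "att_xray a f x \<theta> = (LINT t|lborel. exp (- beam a (x + t *\<^sub>R \<theta>) \<theta>) * f (x + t *\<^sub>R \<theta>))"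

end

theory Submission
  imports Defs
begin

text \<open>
  Along the line through \<open>x\<close> with unit direction \<open>\<theta>\<close> one has
  \<open>\<bar>x + t\<theta>\<bar>\<^sup>2 = p + (t + x\<cdot>\<theta>)\<^sup>2\<close> with \<open>p = \<bar>x\<bar>\<^sup>2 - (x\<cdot>\<theta>)\<^sup>2\<close>, the squared distance of the line from
  the origin. Write the radial functions as \<open>a(x) = A(\<bar>x\<bar>\<^sup>2)\<close> and \<open>f(x) = F(\<bar>x\<bar>\<^sup>2)\<close>. Translating
  the parameter of the line shows that the attenuated transform is a function of \<open>p\<close> alone,
  \<open>H(p) = \<integral> exp (- \<integral>\<^sub>0\<^sup>\<infinity> A(p + (t + w)\<^sup>2) dw) F(p + t\<^sup>2) dt\<close>,
  the foot point of the line having become the origin of \<open>t\<close>. So it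
  suffices to find \<open>F\<^sub>0\<close>, smooth and of compact support on \<open>[0,\<infinity>)\<close>, with
  \<open>H(p) = \<integral> F\<^sub>0(p + s\<^sup>2) ds\<close>; then \<open>f\<^sub>0(x) = F\<^sub>0(\<bar>x\<bar>\<^sup>2)\<close>. This is an Abel equation, solved by
  \<open>F\<^sub>0(q) = -\<pi>\<^sup>-\<^sup>1 \<integral> H'(q + t\<^sup>2) dt\<close>: inserting it leaves the integral of \<open>H'(p + \<bar>z\<bar>\<^sup>2)\<close> over the
  plane, which equals \<open>\<pi> \<integral>\<^sub>0\<^sup>\<infinity> H'(p + r) dr = -\<pi> H(p)\<close> since a disc of squared radius \<open>r\<close> has area
  \<open>\<pi> r\<close>.

  Smoothness is the point that needs care: everything is expressed in the squared radius, and the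
  boundary point \<open>0\<close> of \<open>[0,\<infinity>)\<close> corresponds to the origin of the plane. One-sided
  smoothness on \<open>[0,\<infinity>)\<close> turns out to be exactly the right notion. In one direction, an even smooth
  function of \<open>r\<close> is a one-sidedly smooth function of \<open>q = r\<^sup>2\<close> (Whitney's theorem,
  \<open>smooth_profile_sqrt\<close>), which gives \<open>A\<close> and \<open>F\<close>. In the other, composing a one-sidedly smooth
  function with \<open>\<bar>x\<bar>\<^sup>2\<close>, which only takes values in \<open>[0,\<infinity>)\<close>, gives a smooth function on the plane
  (\<open>Ck_norm_square\<close>). In between, the class is preserved by all operations in the formulas for
  \<open>H\<close> and \<open>F\<^sub>0\<close>, in which the integration variables enter as parameters; hence the families below.
\<close>

section \<open>Families of one-sidedly smooth functions\<close>

text \<open>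
  \<open>\<Phi>\<close> is \<open>k\<close> times differentiable in \<open>p\<close>, with derivatives jointly continuous in \<open>p\<close> and the
  parameter \<open>t\<close>. Derivatives are taken within \<open>U\<close>, so for \<open>U = {0..}\<close> they are one-sided at \<open>0\<close>.
  The derivative is quantified existentially rather than written with an operator, so that it can
  be given by a formula in each closure property.
\<close>
primrec smooth_family ::
  "nat \<Rightarrow> real set \<Rightarrow> 'p::topological_space set \<Rightarrow> (real \<Rightarrow> 'p \<Rightarrow> 'b::real_normed_vector) \<Rightarrow> bool" where
  "smooth_family 0 U T \<Phi> \<longleftrightarrow> continuous_on (U \<times> T) (\<lambda>(p, t). \<Phi> p t)"
| "smooth_family (Suc k) U T \<Phi> \<longleftrightarrow>
     continuous_on (U \<times> T) (\<lambda>(p, t). \<Phi> p t) \<and>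
     (\<exists>\<Phi>'. (\<forall>p\<in>U. \<forall>t\<in>T. ((\<lambda>p. \<Phi> p t) has_vector_derivative \<Phi>' p t) (at p within U)) \<and>
           smooth_family k U T \<Phi>')"

lemma smooth_family_continuous:
  "smooth_family k U T \<Phi> \<Longrightarrow> continuous_on (U \<times> T) (\<lambda>(p, t). \<Phi> p t)"
  by (cases k) auto

lemma smooth_family_SucI:
  assumes "continuous_on (U \<times> T) (\<lambda>(p, t). \<Phi> p t)"
    and "\<And>p t. p \<in> U \<Longrightarrow> t \<in> T \<Longrightarrow> ((\<lambda>p. \<Phi> p t) has_vector_derivative \<Phi>' p t) (at p within U)"
    and "smooth_family k U T \<Phi>'"
  shows "smooth_family (Suc k) U T \<Phi>"
  using assms by auto

lemma smooth_family_SucE: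
  assumes "smooth_family (Suc k) U T \<Phi>"
  obtains \<Phi>' where
    "\<And>p t. p \<in> U \<Longrightarrow> t \<in> T \<Longrightarrow> ((\<lambda>p. \<Phi> p t) has_vector_derivative \<Phi>' p t) (at p within U)"
    "smooth_family k U T \<Phi>'"
  using assms by auto

lemma smooth_family_cong:
  assumes "\<And>p t. p \<in> U \<Longrightarrow> t \<in> T \<Longrightarrow> \<Phi> p t = \<Psi> p t"
  shows "smooth_family k U T \<Phi> \<longleftrightarrow> smooth_family k U T \<Psi>"
proof -
  have c: "continuous_on (U \<times> T) (\<lambda>(p, t). \<Phi> p t) \<longleftrightarrow> continuous_on (U \<times> T) (\<lambda>(p, t). \<Psi> p t)"
    by (rule continuous_on_cong) (auto simp: assms)
  have d: "((\<lambda>p. \<Phi> p t) has_vector_derivative D) (at p within U) \<longleftrightarrow>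
        ((\<lambda>p. \<Psi> p t) has_vector_derivative D) (at p within U)" if "p \<in> U" "t \<in> T" for p t D
    by (rule has_vector_derivative_cong_ev) (auto simp: assms that)
  show ?thesis
    by (cases k) (simp_all add: c d)
qed

lemma smooth_family_lower:
  "smooth_family (Suc k) U T \<Phi> \<Longrightarrow> smooth_family k U T \<Phi>"
proof (induction k arbitrary: \<Phi>)
  case 0
  then show ?case by simp
next
  case (Suc k)
  obtain \<Phi>' where 1: "\<And>p t. p \<in> U \<Longrightarrow> t \<in> T \<Longrightarrow> ((\<lambda>p. \<Phi> p t) has_vector_derivative \<Phi>' p t) (at p within U)"
    "smooth_family (Suc k) U T \<Phi>'"
    using smooth_family_SucE[OF Suc.prems] by blast
  show ?case
    using smooth_family_SucI[OF smooth_family_continuous[OF Suc.prems] 1(1) Suc.IH[OF 1(2)]] by blast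
qed

lemma smooth_family_add:
  assumes "smooth_family k U T \<Phi>" "smooth_family k U T \<Psi>"
  shows "smooth_family k U T (\<lambda>p t. \<Phi> p t + \<Psi> p t)"
  using assms
proof (induction k arbitrary: \<Phi> \<Psi>)
  case 0
  then show ?case by (auto simp: case_prod_beta intro: continuous_on_add)
next
  case (Suc k)
  obtain \<Phi>' where 1: "\<And>p t. p \<in> U \<Longrightarrow> t \<in> T \<Longrightarrow> ((\<lambda>p. \<Phi> p t) has_vector_derivative \<Phi>' p t) (at p within U)"
    "smooth_family k U T \<Phi>'"
    using smooth_family_SucE[OF Suc.prems(1)] by blast
  obtain \<Psi>' where 2: "\<And>p t. p \<in> U \<Longrightarrow> t \<in> T \<Longrightarrow> ((\<lambda>p. \<Psi> p t) has_vector_derivative \<Psi>' p t) (at p within U)"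
    "smooth_family k U T \<Psi>'"
    using smooth_family_SucE[OF Suc.prems(2)] by blast
  show ?case
  proof (rule smooth_family_SucI)
    show "continuous_on (U \<times> T) (\<lambda>(p, t). \<Phi> p t + \<Psi> p t)"
      using Suc.prems[THEN smooth_family_continuous]
      by (auto simp: case_prod_beta intro: continuous_on_add)
    show "smooth_family k U T (\<lambda>p t. \<Phi>' p t + \<Psi>' p t)"
      using 1 2 Suc.IH by blast
  qed (rule has_vector_derivative_add[OF 1(1) 2(1)])
qed

lemma smooth_family_scaleR:
  assumes "continuous_on T c" "smooth_family k U T \<Phi>"
  shows "smooth_family k U T (\<lambda>p t. c t *\<^sub>R \<Phi> p t)"
  using assms(2)
proof (induction k arbitrary: \<Phi>)
  have c: "continuous_on (U \<times> T) (\<lambda>z. c (snd z))"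
    by (rule continuous_on_compose2[OF assms(1)]) (auto intro: continuous_intros)
  {
    case 0
    then show ?case
      using c by (auto simp: case_prod_beta intro: continuous_intros)
  next
    case (Suc k)
    obtain \<Phi>' where 1: "\<And>p t. p \<in> U \<Longrightarrow> t \<in> T \<Longrightarrow> ((\<lambda>p. \<Phi> p t) has_vector_derivative \<Phi>' p t) (at p within U)"
      "smooth_family k U T \<Phi>'"
      using smooth_family_SucE[OF Suc.prems] by blast
    show ?case
    proof (rule smooth_family_SucI)
      show "continuous_on (U \<times> T) (\<lambda>(p, t). c t *\<^sub>R \<Phi> p t)"
        using c smooth_family_continuous[OF Suc.prems]
        by (auto simp: case_prod_beta intro: continuous_intros)
      show "smooth_family k U T (\<lambda>p t. c t *\<^sub>R \<Phi>' p t)"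
        using 1 Suc.IH by blast
    qed (rule bounded_linear.has_vector_derivative[OF bounded_linear_scaleR_right 1(1)])
  }
qed

lemma smooth_family_mult:
  fixes \<Phi> \<Psi> :: "real \<Rightarrow> 'p::topological_space \<Rightarrow> 'k::real_normed_algebra"
  assumes "smooth_family k U T \<Phi>" "smooth_family k U T \<Psi>"
  shows "smooth_family k U T (\<lambda>p t. \<Phi> p t * \<Psi> p t)"
  using assms
proof (induction k arbitrary: \<Phi> \<Psi>)
  case 0
  then show ?case by (auto simp: case_prod_beta intro: continuous_on_mult)
next
  case (Suc k)
  obtain \<Phi>' where 1: "\<And>p t. p \<in> U \<Longrightarrow> t \<in> T \<Longrightarrow> ((\<lambda>p. \<Phi> p t) has_vector_derivative \<Phi>' p t) (at p within U)"
    "smooth_family k U T \<Phi>'"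
    using smooth_family_SucE[OF Suc.prems(1)] by blast
  obtain \<Psi>' where 2: "\<And>p t. p \<in> U \<Longrightarrow> t \<in> T \<Longrightarrow> ((\<lambda>p. \<Psi> p t) has_vector_derivative \<Psi>' p t) (at p within U)"
    "smooth_family k U T \<Psi>'"
    using smooth_family_SucE[OF Suc.prems(2)] by blast
  show ?case
  proof (rule smooth_family_SucI)
    show "continuous_on (U \<times> T) (\<lambda>(p, t). \<Phi> p t * \<Psi> p t)"
      using Suc.prems[THEN smooth_family_continuous]
      by (auto simp: case_prod_beta intro: continuous_on_mult)
    show "smooth_family k U T (\<lambda>p t. \<Phi> p t * \<Psi>' p t + \<Phi>' p t * \<Psi> p t)"
      by (rule smooth_family_add[OF Suc.IH[OF smooth_family_lower[OF Suc.prems(1)] 2(2)]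
            Suc.IH[OF 1(2) smooth_family_lower[OF Suc.prems(2)]]])
  qed (rule has_vector_derivative_mult[OF 1(1) 2(1)])
qed

lemma smooth_family_exp:
  fixes \<Phi> :: "real \<Rightarrow> 'p::topological_space \<Rightarrow> 'k::{real_normed_field, banach}"
  assumes "smooth_family k U T \<Phi>"
  shows "smooth_family k U T (\<lambda>p t. exp (\<Phi> p t))"
  using assms
proof (induction k)
  case 0
  then show ?case by (auto simp: case_prod_beta intro: continuous_on_exp)
next
  case (Suc k)
  obtain \<Phi>' where 1: "\<And>p t. p \<in> U \<Longrightarrow> t \<in> T \<Longrightarrow> ((\<lambda>p. \<Phi> p t) has_vector_derivative \<Phi>' p t) (at p within U)"
    "smooth_family k U T \<Phi>'"
    using smooth_family_SucE[OF Suc.prems] by blast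
  have s: "smooth_family k U T (\<lambda>p t. \<Phi>' p t * exp (\<Phi> p t))"
    by (rule smooth_family_mult[OF 1(2) Suc.IH[OF smooth_family_lower[OF Suc.prems]]])
  have d: "((\<lambda>p. exp (\<Phi> p t)) has_vector_derivative \<Phi>' p t * exp (\<Phi> p t)) (at p within U)"
    if "p \<in> U" "t \<in> T" for p t
    using field_vector_diff_chain_within[OF 1(1)[OF that] DERIV_subset[OF DERIV_exp]]
    by (simp add: o_def)
  have c: "continuous_on (U \<times> T) (\<lambda>(p, t). exp (\<Phi> p t))"
    using smooth_family_continuous[OF Suc.prems]
    by (auto simp: case_prod_beta intro: continuous_on_exp)
  show ?case
    by (rule smooth_family_SucI[OF c d s])
qed

text \<open>
  The substitutions needed later are \<open>p + t\<^sup>2\<close>, \<open>p + (t + w)\<^sup>2\<close> and \<open>\<tau> r\<close>, all affine in the variable of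
  differentiation with coefficients depending on the parameter; differentiation then only
  produces another factor \<open>c t\<close>.
\<close>
lemma smooth_family_affine:
  fixes \<phi> :: "'p::topological_space \<Rightarrow> 'q::topological_space"
  assumes \<Phi>: "smooth_family k V S \<Phi>"
    and c: "continuous_on T c" and d: "continuous_on T d" and \<phi>: "continuous_on T \<phi>"
    and V: "\<And>p t. p \<in> U \<Longrightarrow> t \<in> T \<Longrightarrow> c t * p + d t \<in> V" and S: "\<phi> ` T \<subseteq> S"
  shows "smooth_family k U T (\<lambda>p t. \<Phi> (c t * p + d t) (\<phi> t))"
  using \<Phi>
proof (induction k arbitrary: \<Phi>)
  have cont: "continuous_on (U \<times> T) (\<lambda>(p, t). \<Psi> (c t * p + d t) (\<phi> t))"
    if "continuous_on (V \<times> S) (\<lambda>(p, t). \<Psi> p t)" for \<Psi> :: "real \<Rightarrow> 'q \<Rightarrow> 'a"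
  proof -
    have snd: "continuous_on (U \<times> T) (\<lambda>z. g (snd z))" if "continuous_on T g"
      for g :: "'p \<Rightarrow> 'x::topological_space"
      by (rule continuous_on_compose2[OF that]) (auto intro: continuous_intros)
    have "continuous_on (U \<times> T) (\<lambda>z. (c (snd z) * fst z + d (snd z), \<phi> (snd z)))"
      using snd[OF c] snd[OF d] snd[OF \<phi>] by (intro continuous_intros)
    from continuous_on_compose2[OF that this] show ?thesis
      using V S by (auto simp: case_prod_beta image_subset_iff)
  qed
  {
    case 0
    then show ?case using cont by simp
  next
    case (Suc k)
    obtain \<Phi>' where 1: "\<And>p t. p \<in> V \<Longrightarrow> t \<in> S \<Longrightarrow> ((\<lambda>p. \<Phi> p t) has_vector_derivative \<Phi>' p t) (at p within V)"
      "smooth_family k V S \<Phi>'"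
      using smooth_family_SucE[OF Suc.prems] by blast
    show ?case
    proof (rule smooth_family_SucI)
      show "continuous_on (U \<times> T) (\<lambda>(p, t). \<Phi> (c t * p + d t) (\<phi> t))"
        using cont smooth_family_continuous[OF Suc.prems] by blast
      show "smooth_family k U T (\<lambda>p t. c t *\<^sub>R \<Phi>' (c t * p + d t) (\<phi> t))"
        by (intro smooth_family_scaleR c Suc.IH 1)
      fix p t assume pt: "p \<in> U" "t \<in> T"
      have "((\<lambda>p. c t * p + d t) has_vector_derivative c t) (at p within U)"
        by (auto intro!: derivative_eq_intros)
      moreover have "((\<lambda>p. \<Phi> p (\<phi> t)) has_vector_derivative \<Phi>' (c t * p + d t) (\<phi> t))
          (at (c t * p + d t) within (\<lambda>p. c t * p + d t) ` U)"
        by (rule has_vector_derivative_within_subset[OF 1(1)]) (use V S pt in auto)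
      ultimately show "((\<lambda>p. \<Phi> (c t * p + d t) (\<phi> t)) has_vector_derivative c t *\<^sub>R \<Phi>' (c t * p + d t) (\<phi> t)) (at p within U)"
        using vector_diff_chain_within[of "\<lambda>p. c t * p + d t" "c t" p U "\<lambda>p. \<Phi> p (\<phi> t)"]
        by (simp add: o_def)
    qed
  }
qed

text \<open>
  Differentiation under the integral sign. The domain of integration does not depend on \<open>p\<close> or
  \<open>t\<close>, which is why the beam integrals below are written over a fixed interval.
\<close>
lemma smooth_family_integral:
  fixes \<Phi> :: "real \<Rightarrow> 'p::topological_space \<times> 'w::euclidean_space \<Rightarrow> 'b::banach"
  assumes "smooth_family k U (T \<times> cbox a b) \<Phi>" "convex U"
  shows "smooth_family k U T (\<lambda>p t. integral (cbox a b) (\<lambda>w. \<Phi> p (t, w)))"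
  using assms(1)
proof (induction k arbitrary: \<Phi>)
  have cont: "continuous_on (U \<times> T) (\<lambda>(p, t). integral (cbox a b) (\<lambda>w. \<Psi> p (t, w)))"
    if "continuous_on (U \<times> T \<times> cbox a b) (\<lambda>(p, t). \<Psi> p t)"
    for \<Psi> :: "real \<Rightarrow> 'p \<times> 'w \<Rightarrow> 'b"
  proof -
    have "continuous_on ((U \<times> T) \<times> cbox a b) (\<lambda>z. (fst (fst z), (snd (fst z), snd z)))"
      by (intro continuous_intros)
    from continuous_on_compose2[OF that this]
    have "continuous_on ((U \<times> T) \<times> cbox a b) (\<lambda>x. \<Psi> (fst (fst x)) (snd (fst x), snd x))"
      by (auto simp: case_prod_beta image_subset_iff)
    then have "continuous_on (U \<times> T) (\<lambda>z. integral (cbox a b) (\<lambda>w. \<Psi> (fst z) (snd z, w)))"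
      by (intro integral_continuous_on_param) (simp only: case_prod_unfold)
    then show ?thesis
      by (simp only: case_prod_unfold)
  qed
  {
    case 0
    then show ?case using cont by simp
  next
    case (Suc k)
    obtain \<Phi>' where 1: "\<And>p t. p \<in> U \<Longrightarrow> t \<in> T \<times> cbox a b \<Longrightarrow> ((\<lambda>p. \<Phi> p t) has_vector_derivative \<Phi>' p t) (at p within U)"
      "smooth_family k U (T \<times> cbox a b) \<Phi>'"
      using smooth_family_SucE[OF Suc.prems] by blast
    have slice: "continuous_on (U \<times> cbox a b) (\<lambda>(p, w). \<Psi> p (t, w))"
      if "continuous_on (U \<times> T \<times> cbox a b) (\<lambda>(p, t). \<Psi> p t)" "t \<in> T"
      for \<Psi> :: "real \<Rightarrow> 'p \<times> 'w \<Rightarrow> 'b" and t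
    proof -
      have "continuous_on (U \<times> cbox a b) (\<lambda>z. (fst z, (t, snd z)))"
        by (intro continuous_intros)
      from continuous_on_compose2[OF that(1) this] show ?thesis
        using that(2) by (force simp: case_prod_beta)
    qed
    show ?case
    proof (rule smooth_family_SucI)
      show "continuous_on (U \<times> T) (\<lambda>(p, t). integral (cbox a b) (\<lambda>w. \<Phi> p (t, w)))"
        using cont smooth_family_continuous[OF Suc.prems] by blast
      show "smooth_family k U T (\<lambda>p t. integral (cbox a b) (\<lambda>w. \<Phi>' p (t, w)))"
        using Suc.IH 1 by blast
      fix p t assume pt: "p \<in> U" "t \<in> T"
      show "((\<lambda>p. integral (cbox a b) (\<lambda>w. \<Phi> p (t, w))) has_vector_derivative
          integral (cbox a b) (\<lambda>w. \<Phi>' p (t, w))) (at p within U)"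
      proof (rule leibniz_rule_vector_derivative)
        show "continuous_on (U \<times> cbox a b) (\<lambda>(p, w). \<Phi>' p (t, w))"
          using slice[OF smooth_family_continuous[OF 1(2)] pt(2)] .
        have c: "continuous_on (U \<times> cbox a b) (\<lambda>(p, w). \<Phi> p (t, w))"
          using slice[OF smooth_family_continuous[OF Suc.prems] pt(2)] .
        fix q assume "q \<in> U"
        then have "continuous_on (cbox a b) (\<lambda>w. \<Phi> q (t, w))"
          using continuous_on_compose2[OF c, of "cbox a b" "\<lambda>w. (q, w)"]
          by (force intro: continuous_intros)
        then show "(\<lambda>w. \<Phi> q (t, w)) integrable_on cbox a b"
          by (rule integrable_continuous)
      qed (use 1 pt assms in auto)
    qed
  }
qed

section \<open>Profiles: smooth functions of one variable\<close>

text \<open>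
  A function without parameter is a family over a one-point parameter set.
\<close>
abbreviation smooth_profile :: "nat \<Rightarrow> real set \<Rightarrow> (real \<Rightarrow> 'b::real_normed_vector) \<Rightarrow> bool" where
  "smooth_profile k U F \<equiv> smooth_family k U {0::real} (\<lambda>p _. F p)"

lemma smooth_profile_continuous:
  assumes "smooth_profile k U F"
  shows "continuous_on U F"
proof -
  have "continuous_on U (\<lambda>p. (p, 0::real))"
    by (intro continuous_intros)
  from continuous_on_compose2[OF smooth_family_continuous[OF assms] this] show ?thesis
    by auto
qed

lemma continuous_on_profile:
  assumes "continuous_on U F"
  shows "continuous_on (U \<times> T) (\<lambda>(p, t). F p)"
  unfolding case_prod_unfold
  by (rule continuous_on_compose2[OF assms]) (auto intro!: continuous_intros)

lemma smooth_profile_0: "continuous_on U F \<Longrightarrow> smooth_profile 0 U F"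
  using continuous_on_profile by simp

lemma smooth_profile_SucI:
  assumes "\<And>p. p \<in> U \<Longrightarrow> (F has_vector_derivative F' p) (at p within U)"
    and "smooth_profile k U F'"
  shows "smooth_profile (Suc k) U F"
proof (rule smooth_family_SucI)
  have "continuous_on U F"
    using assms(1) by (auto simp: continuous_on_eq_continuous_within intro: has_vector_derivative_continuous)
  then show "continuous_on (U \<times> {0}) (\<lambda>(p, t). F p)"
    by (rule continuous_on_profile)
qed (use assms in auto)

lemma smooth_profile_SucE:
  assumes "smooth_profile (Suc k) U F"
  obtains F' where "\<And>p. p \<in> U \<Longrightarrow> (F has_vector_derivative F' p) (at p within U)"
    and "smooth_profile k U F'"
proof -
  obtain \<Phi>' where 1: "\<And>p t. p \<in> U \<Longrightarrow> t \<in> {0::real} \<Longrightarrow> (F has_vector_derivative \<Phi>' p t) (at p within U)"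
    and 2: "smooth_family k U {0::real} \<Phi>'"
    using smooth_family_SucE[OF assms] by blast
  show ?thesis
  proof
    show "(F has_vector_derivative \<Phi>' p 0) (at p within U)" if "p \<in> U" for p
      using 1[of p 0] that by simp
    show "smooth_profile k U (\<lambda>p. \<Phi>' p 0)"
      using 2 by (subst smooth_family_cong[of U "{0}" _ \<Phi>']) auto
  qed
qed

lemma smooth_profile_affine:
  assumes "smooth_profile k V F"
    and "continuous_on T c" "continuous_on T d"
    and "\<And>p t. p \<in> U \<Longrightarrow> t \<in> T \<Longrightarrow> c t * p + d t \<in> V"
  shows "smooth_family k U T (\<lambda>p t. F (c t * p + d t))"
  using smooth_family_affine[OF assms(1-3) continuous_on_const[of T "0::real"], of U] assms(4)
  by (simp add: image_subset_iff)

lemma smooth_profile_integral: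
  fixes \<Phi> :: "real \<Rightarrow> 'w::euclidean_space \<Rightarrow> 'b::banach"
  assumes "smooth_family k U (cbox a b) \<Phi>" "convex U"
  shows "smooth_profile k U (\<lambda>p. integral (cbox a b) (\<Phi> p))"
proof -
  have "smooth_family k U ({0::real} \<times> cbox a b) (\<lambda>p z. \<Phi> ((\<lambda>_. 1) z * p + (\<lambda>_. 0) z) (snd z))"
    by (rule smooth_family_affine[OF assms(1)]) (auto intro!: continuous_intros)
  then have "smooth_family k U ({0::real} \<times> cbox a b) (\<lambda>p z. \<Phi> p (snd z))"
    by simp
  from smooth_family_integral[OF this assms(2)] show ?thesis
    by simp
qed

lemma at_within_interval_neq_bot:
  assumes "p \<in> U" "is_interval U" "q \<in> U" "q \<noteq> p"
  shows "at p within (U::real set) \<noteq> bot"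
proof -
  have "p islimpt U"
    using connected_imp_perfect[of U p] assms by (auto simp: is_interval_connected)
  then show ?thesis
    by (simp add: trivial_limit_within)
qed

text \<open>
  Membership in the class for every \<open>k\<close> provides a derivative for each \<open>k\<close> separately; by
  uniqueness they all agree with any derivative \<open>D\<close> fixed in advance.
\<close>
lemma smooth_profile_derivative:
  assumes F: "smooth_profile (Suc k) U F"
    and U: "\<And>p. p \<in> U \<Longrightarrow> at p within U \<noteq> bot"
    and d: "\<And>p. p \<in> U \<Longrightarrow> (F has_vector_derivative D p) (at p within U)"
  shows "smooth_profile k U D"
proof -
  obtain F' where 1: "\<And>p. p \<in> U \<Longrightarrow> (F has_vector_derivative F' p) (at p within U)"
    and 2: "smooth_profile k U F'"
    using smooth_profile_SucE[OF F] by blast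
  have "F' p = D p" if "p \<in> U" for p
    using vector_derivative_unique_within[OF U 1 d] that by blast
  with 2 show ?thesis
    by (simp cong: smooth_family_cong)
qed

section \<open>Radial smooth functions and their profiles\<close>

text \<open>
  For \<open>c = 1\<close> and \<open>c = -1\<close>: differentiation exchanges even and odd functions.
\<close>
lemma has_vector_derivative_reflect:
  assumes "\<And>r. (g has_vector_derivative g' r) (at (r::real))"
    and "\<And>r. g (- r) = c *\<^sub>R g r"
  shows "g' (- r) = - c *\<^sub>R g' r"
proof -
  have "((\<lambda>r. g (- r)) has_vector_derivative (- 1) *\<^sub>R g' (- r)) (at r)"
    using vector_diff_chain_at[of uminus "-1" r g "g' (- r)"] assms(1)
    by (simp add: o_def has_vector_derivative_minus[OF has_vector_derivative_id])
  moreover have "((\<lambda>r. g (- r)) has_vector_derivative c *\<^sub>R g' r) (at r)"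
    unfolding assms(2)
    by (rule bounded_linear.has_vector_derivative[OF bounded_linear_scaleR_right assms(1)])
  ultimately have "- g' (- r) = c *\<^sub>R g' r"
    using vector_derivative_unique_at by force
  then show ?thesis
    by (metis minus_minus scaleR_minus_left)
qed

text \<open>
  Whitney's theorem on even functions. The derivative of \<open>g(\<surd>q)\<close> is \<open>D(\<surd>q)\<close> with
  \<open>D(r) = g'(r) / (2 r)\<close>. As \<open>g'\<close> is odd it vanishes at \<open>0\<close>, so
  \<open>D(r) = 1/2 \<integral>\<^sub>0\<^sup>1 g''(\<tau> r) d\<tau>\<close>, which is again even and smooth across \<open>0\<close>, at the cost of two
  derivatives. Hence the induction, and the order \<open>2 k\<close>.
\<close>
lemma smooth_profile_sqrt:
  fixes g :: "real \<Rightarrow> 'b::banach"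
  assumes "smooth_profile (2 * k) UNIV g" and "\<And>r. g (- r) = g r"
  shows "smooth_profile k {0..} (\<lambda>q. g (sqrt q))"
  using assms
proof (induction k arbitrary: g)
  have cont: "continuous_on {0..} (\<lambda>q. h (sqrt q))" if "smooth_profile n UNIV h"
    for h :: "real \<Rightarrow> 'b" and n
    by (rule continuous_on_compose2[OF smooth_profile_continuous[OF that]])
       (auto intro!: continuous_intros)
  {
    case 0
    show ?case
      by (rule smooth_profile_0[OF cont[OF 0(1)]])
  next
    case (Suc k)
    have g: "smooth_profile (Suc (Suc (2 * k))) UNIV g"
      using Suc.prems(1) by simp
    obtain g1 where g1: "\<And>r. r \<in> UNIV \<Longrightarrow> (g has_vector_derivative g1 r) (at r)"
      "smooth_profile (Suc (2 * k)) UNIV g1"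
      using smooth_profile_SucE[OF g] by blast
    obtain g2 where g2: "\<And>r. r \<in> UNIV \<Longrightarrow> (g1 has_vector_derivative g2 r) (at r)"
      "smooth_profile (2 * k) UNIV g2"
      using smooth_profile_SucE[OF g1(2)] by blast
    note g1' = g1(1)[OF UNIV_I] and g2' = g2(1)[OF UNIV_I]
    have odd: "g1 (- r) = - g1 r" for r
      using has_vector_derivative_reflect[OF g1', of 1] Suc.prems(2) by simp
    have even: "g2 (- r) = g2 r" for r
      using has_vector_derivative_reflect[OF g2', of "- 1"] odd by simp
    have g1_0: "g1 0 = 0"
      using odd[of 0] by (simp add: eq_neg_iff_add_eq_0 flip: scaleR_2)
    define D where "D r = (1/2) *\<^sub>R integral (cbox 0 1) (\<lambda>\<tau>::real. g2 (\<tau> * r))" for r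
    have "smooth_family (2 * k) UNIV (cbox 0 1) (\<lambda>r \<tau>. g2 (\<tau> * r + 0))"
      by (rule smooth_profile_affine[OF g2(2)]) (auto intro!: continuous_intros)
    then have "smooth_profile (2 * k) UNIV (\<lambda>r. integral (cbox 0 1) (\<lambda>\<tau>::real. g2 (\<tau> * r + 0)))"
      by (rule smooth_profile_integral) simp
    then have D: "smooth_profile (2 * k) UNIV D"
      unfolding D_def by (intro smooth_family_scaleR) simp_all
    have D_even: "D (- r) = D r" for r
      by (simp add: D_def even)
    have g1_D: "g1 r = (2 * r) *\<^sub>R D r" for r
    proof -
      have "((\<lambda>\<tau>. r *\<^sub>R g2 (\<tau> * r)) has_integral (g1 (1 * r) - g1 (0 * r))) {0..1}"
      proof (rule fundamental_theorem_of_calculus)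
        fix \<tau> :: real
        show "((\<lambda>\<tau>. g1 (\<tau> * r)) has_vector_derivative r *\<^sub>R g2 (\<tau> * r)) (at \<tau> within {0..1})"
          using vector_diff_chain_within[of "\<lambda>\<tau>. \<tau> * r" r \<tau> "{0..1}" g1 "g2 (\<tau> * r)"]
            has_vector_derivative_at_within[OF g2'] has_vector_derivative_mult_left[OF has_vector_derivative_id, of r]
          by (simp add: o_def)
      qed simp
      from integral_unique[OF this] show ?thesis
        by (simp add: D_def g1_0)
    qed
    have pos: "((\<lambda>q. g (sqrt q)) has_vector_derivative D (sqrt q)) (at q)" if "q > 0" for q
    proof -
      have "(sqrt has_vector_derivative inverse (sqrt q) / 2) (at q)"
        using DERIV_real_sqrt[OF that] by (simp add: has_real_derivative_iff_has_vector_derivative)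
      from vector_diff_chain_at[OF this g1'] show ?thesis
        using that by (simp add: o_def g1_D)
    qed
    have ftc: "integral {0..q} (\<lambda>q. D (sqrt q)) = g (sqrt q) - g 0" if "q \<ge> 0" for q
    proof (rule integral_unique)
      have "((\<lambda>q. D (sqrt q)) has_integral g (sqrt q) - g (sqrt 0)) {0..q}"
        by (rule fundamental_theorem_of_calculus_interior_strong[of "{}"])
           (use that pos in \<open>auto intro: continuous_on_subset[OF cont[OF g]]\<close>)
      then show "((\<lambda>q. D (sqrt q)) has_integral g (sqrt q) - g 0) {0..q}"
        by simp
    qed
    \<comment> \<open>\<open>\<surd>q\<close> is not differentiable at \<open>0\<close>; there the derivative comes from the integral formula.\<close>
    have deriv: "((\<lambda>q. g (sqrt q)) has_vector_derivative D (sqrt q)) (at q within {0..})" if "q \<ge> 0" for q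
    proof -
      have "((\<lambda>u. integral {0..u} (\<lambda>q. D (sqrt q))) has_vector_derivative D (sqrt q)) (at q within {0..q+1})"
        by (rule integral_has_vector_derivative) (use that in \<open>auto intro: continuous_on_subset[OF cont[OF D]]\<close>)
      then have "((\<lambda>u. integral {0..u} (\<lambda>q. D (sqrt q)) + g 0) has_vector_derivative D (sqrt q)) (at q within {0..q+1})"
        by (auto intro: derivative_eq_intros)
      then have "((\<lambda>q. g (sqrt q)) has_vector_derivative D (sqrt q)) (at q within {0..q+1})"
        by (rule has_vector_derivative_transform[rotated 2]) (use that ftc in auto)
      moreover have "at q within {0..q+1} = at q within {0..}"
        by (rule at_within_nhd[of q "{..<q+1}"]) auto
      ultimately show ?thesis
        by simp
    qed
    show ?case
      by (rule smooth_profile_SucI[OF deriv Suc.IH[OF D D_even]]) simp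
  }
qed

lemma Ck_restrict_line:
  fixes h :: "'a::euclidean_space \<Rightarrow> 'b::real_normed_vector"
  assumes "Ck k h"
  shows "smooth_profile k UNIV (\<lambda>r. h (r *\<^sub>R e))"
  using assms
proof (induction k arbitrary: h)
  case 0
  have "continuous_on UNIV (\<lambda>r. h (r *\<^sub>R e))"
    by (rule continuous_on_compose2[of UNIV h]) (use 0 in \<open>auto intro!: continuous_intros\<close>)
  then show ?case
    by (rule smooth_profile_0)
next
  case (Suc k)
  show ?case
  proof (rule smooth_profile_SucI)
    show "smooth_profile k UNIV (\<lambda>r. frechet_derivative h (at (r *\<^sub>R e)) e)"
      using Suc.IH[of "\<lambda>x. frechet_derivative h (at x) e"] Suc.prems by simp
    fix r :: real
    have "(h has_derivative frechet_derivative h (at (r *\<^sub>R e))) (at (r *\<^sub>R e))"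
      using Suc.prems by (simp add: frechet_derivative_works)
    moreover have "((\<lambda>r. r *\<^sub>R e) has_vector_derivative e) (at r)"
      by (auto intro!: derivative_eq_intros)
    ultimately show "((\<lambda>r. h (r *\<^sub>R e)) has_vector_derivative frechet_derivative h (at (r *\<^sub>R e)) e) (at r within UNIV)"
      using vector_derivative_diff_chain_within[of "\<lambda>r. r *\<^sub>R e" e r UNIV h]
      by (auto simp: o_def intro: has_derivative_at_withinI)
  qed
qed

text \<open>
  The profile is the restriction of the radial function to a ray, in the variable \<open>q = r\<^sup>2\<close>; the
  restriction to the whole line is even because the function is radial.
\<close>
lemma radial_profile:
  fixes a :: "'a::euclidean_space \<Rightarrow> 'b::banach"
  assumes "smooth_compact_support a" "radial a"
  obtains A L where "\<And>k. smooth_profile k {0..} A"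
    and "\<And>x. a x = A ((norm x)\<^sup>2)" and "L > 0" and "\<And>q. q \<ge> L\<^sup>2 \<Longrightarrow> A q = 0"
proof -
  obtain e :: 'a where e: "norm e = 1"
    using norm_Basis nonempty_Basis by blast
  define A where "A q = a (sqrt q *\<^sub>R e)" for q
  have "bounded {x. a x \<noteq> 0}"
    using assms(1) unfolding smooth_compact_support_def
    by (meson bounded_subset closure_subset compact_imp_bounded)
  then obtain L where L: "L > 0" "\<And>x. a x \<noteq> 0 \<Longrightarrow> norm x < L"
    unfolding bounded_pos_less by blast
  show ?thesis
  proof
    have "smooth_profile (2 * k) UNIV (\<lambda>r. a (r *\<^sub>R e))" for k
      using assms(1) by (intro Ck_restrict_line) (simp add: smooth_compact_support_def)
    then show "smooth_profile k {0..} A" for k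
      unfolding A_def using assms(2)
      by (intro smooth_profile_sqrt[where g = "\<lambda>r. a (r *\<^sub>R e)"]) (auto simp: radial_def)
    show "a x = A ((norm x)\<^sup>2)" for x
      using assms(2) e unfolding A_def radial_def by (metis abs_norm_cancel mult.right_neutral norm_scaleR real_sqrt_abs)
    show "A q = 0" if "q \<ge> L\<^sup>2" for q
    proof (rule ccontr)
      assume "A q \<noteq> 0"
      then have "\<bar>sqrt q\<bar> < L"
        using L(2) e unfolding A_def by fastforce
      moreover have "L \<le> sqrt q"
        using that by (rule real_le_rsqrt)
      ultimately show False by linarith
    qed
  qed (rule L)
qed

lemma Ck_continuous: "Ck k h \<Longrightarrow> continuous_on UNIV h"
  by (cases k) (auto intro!: continuous_at_imp_continuous_on differentiable_imp_continuous_within)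

lemma Ck_lower: "Ck (Suc k) h \<Longrightarrow> Ck k h"
proof (induction k arbitrary: h)
  case 0
  then show ?case using Ck_continuous[of "Suc 0" h] by simp
next
  case (Suc k)
  then show ?case by (metis Ck.simps(2))
qed

text \<open>
  By uniqueness of derivatives, an explicit one may replace \<^const>\<open>frechet_derivative\<close> in
  \<^const>\<open>Ck\<close>.
\<close>
lemma Ck_SucI:
  assumes "\<And>x. (h has_derivative D x) (at x)" and "\<And>v. Ck k (\<lambda>x. D x v)"
  shows "Ck (Suc k) h"
proof -
  have "frechet_derivative h (at x) = D x" for x
    using frechet_derivative_at[OF assms(1)[of x]] by simp
  then show ?thesis
    using assms by (auto simp: differentiable_def)
qed

lemma Ck_SucD:
  assumes "Ck (Suc k) h"
  shows "(h has_derivative frechet_derivative h (at x)) (at x)"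
    and "Ck k (\<lambda>x. frechet_derivative h (at x) v)"
  using assms by (simp_all add: frechet_derivative_works)

lemma Ck_const: "Ck k (\<lambda>_. c)"
  by (induction k arbitrary: c) (simp_all add: frechet_derivative_const)

lemma Ck_bounded_linear:
  assumes "bounded_linear h"
  shows "Ck k h"
proof (cases k)
  case 0
  then show ?thesis using assms by (simp add: linear_continuous_on)
next
  case (Suc m)
  show ?thesis
    unfolding Suc by (intro Ck_SucI[OF bounded_linear_imp_has_derivative[OF assms]] Ck_const)
qed

lemma Ck_add: "Ck k g \<Longrightarrow> Ck k h \<Longrightarrow> Ck k (\<lambda>x. g x + h x)"
proof (induction k arbitrary: g h)
  case 0
  then show ?case by (simp add: continuous_on_add)
next
  case (Suc k)
  show ?case
    by (rule Ck_SucI[OF has_derivative_add[OF Ck_SucD(1)[OF Suc.prems(1)] Ck_SucD(1)[OF Suc.prems(2)]]])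
       (rule Suc.IH[OF Ck_SucD(2)[OF Suc.prems(1)] Ck_SucD(2)[OF Suc.prems(2)]])
qed

lemma Ck_scaleR: "Ck k g \<Longrightarrow> Ck k h \<Longrightarrow> Ck k (\<lambda>x. g x *\<^sub>R h x)"
proof (induction k arbitrary: g h)
  case 0
  then show ?case by (simp add: continuous_on_scaleR)
next
  case (Suc k)
  show ?case
    by (rule Ck_SucI[OF has_derivative_scaleR[OF Ck_SucD(1)[OF Suc.prems(1)] Ck_SucD(1)[OF Suc.prems(2)]]])
       (rule Ck_add[OF Suc.IH[OF Ck_lower[OF Suc.prems(1)] Ck_SucD(2)[OF Suc.prems(2)]]
             Suc.IH[OF Ck_SucD(2)[OF Suc.prems(1)] Ck_lower[OF Suc.prems(2)]]])
qed

text \<open>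
  The directional derivative \<open>2 (v \<bullet> x) F'(\<bar>x\<bar>\<^sup>2)\<close> is a linear function times a function of the
  same form, so the induction closes. The derivative of \<open>F\<close> within \<open>{0..}\<close> suffices since
  \<open>\<bar>x\<bar>\<^sup>2\<close> takes no other values.
\<close>
lemma Ck_norm_square:
  assumes "smooth_profile k {0..} F"
  shows "Ck k (\<lambda>x::'a::euclidean_space. F ((norm x)\<^sup>2))"
  using assms
proof (induction k arbitrary: F)
  case 0
  have "continuous_on UNIV (\<lambda>x::'a. F ((norm x)\<^sup>2))"
    by (rule continuous_on_compose2[OF smooth_profile_continuous[OF 0]]) (auto intro!: continuous_intros)
  then show ?case by simp
next
  case (Suc k)
  obtain F' where F': "\<And>q. q \<in> {0..} \<Longrightarrow> (F has_vector_derivative F' q) (at q within {0..})"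
    and "smooth_profile k {0..} F'"
    using smooth_profile_SucE[OF Suc.prems] by blast
  note IH = Suc.IH[OF this(2)]
  show ?case
  proof (rule Ck_SucI)
    fix x :: 'a
    have "((\<lambda>x. (norm x)\<^sup>2) has_derivative (\<lambda>v. 2 * (v \<bullet> x))) (at x within UNIV)"
      unfolding power2_norm_eq_inner
      by (auto intro!: derivative_eq_intros simp: inner_commute)
    moreover have "(F has_derivative (\<lambda>d. d *\<^sub>R F' ((norm x)\<^sup>2))) (at ((norm x)\<^sup>2) within range (\<lambda>x::'a. (norm x)\<^sup>2))"
      using F'[of "(norm x)\<^sup>2"] unfolding has_vector_derivative_def
      by (auto intro: has_derivative_subset)
    ultimately show "((\<lambda>x. F ((norm x)\<^sup>2)) has_derivative (\<lambda>v. (2 * (v \<bullet> x)) *\<^sub>R F' ((norm x)\<^sup>2))) (at x)"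
      using diff_chain_within[of "\<lambda>x::'a. (norm x)\<^sup>2" "\<lambda>v. 2 * (v \<bullet> x)" x UNIV F "\<lambda>d. d *\<^sub>R F' ((norm x)\<^sup>2)"]
      by (simp add: o_def)
    fix v :: 'a
    have "Ck k (\<lambda>x. 2 * (v \<bullet> x))"
      by (rule Ck_bounded_linear) (intro bounded_linear_const_mult bounded_linear_inner_right)
    then show "Ck k (\<lambda>x. (2 * (v \<bullet> x)) *\<^sub>R F' ((norm x)\<^sup>2))"
      by (rule Ck_scaleR[OF _ IH])
  qed
qed

lemma smooth_compact_support_norm_square:
  assumes "\<And>k. smooth_profile k {0..} F" and "\<And>q. q \<ge> L\<^sup>2 \<Longrightarrow> F q = 0"
  shows "smooth_compact_support (\<lambda>x::'a::euclidean_space. F ((norm x)\<^sup>2))"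
proof -
  have "norm x \<le> \<bar>L\<bar>" if "F ((norm x)\<^sup>2) \<noteq> 0" for x :: 'a
    using that assms(2)[of "(norm x)\<^sup>2"] abs_le_square_iff[of L "norm x"] by force
  then have "{x::'a. F ((norm x)\<^sup>2) \<noteq> 0} \<subseteq> cball 0 \<bar>L\<bar>"
    by auto
  then have "bounded {x::'a. F ((norm x)\<^sup>2) \<noteq> 0}"
    using bounded_cball bounded_subset by blast
  then show ?thesis
    unfolding smooth_compact_support_def by (simp add: Ck_norm_square assms(1))
qed

section \<open>Abel's integral equation\<close>

text \<open>
  The disc of squared radius \<open>r\<close> has area \<open>\<pi> r\<close>, so \<open>\<bar>z\<bar>\<^sup>2\<close> maps Lebesgue measure of the plane to
  \<open>\<pi>\<close> times Lebesgue measure of the half-line. The sign is reversed because Borel measures on the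
  line are compared on the sets \<open>{u<..}\<close>, which must have finite measure.
\<close>
lemma distr_norm_square_plane:
  "distr (lborel :: (real \<times> real) measure) borel (\<lambda>z. - (norm z)\<^sup>2) =
     density lborel (\<lambda>u. ennreal (pi * indicator {..0} u))" (is "?M = ?N")
proof (rule measure_eqI_lessThan)
  have M: "emeasure ?M {u<..} = (if u < 0 then ennreal (- u * pi) else 0)" for u
  proof -
    have "emeasure ?M {u<..} = emeasure lborel {z::real\<times>real. u < - (norm z)\<^sup>2}"
      by (simp add: emeasure_distr vimage_def)
    also have "{z::real\<times>real. u < - (norm z)\<^sup>2} = (if u < 0 then ball 0 (sqrt (- u)) else {})"
    proof (cases "u < 0")
      case True
      have "u < - (norm z)\<^sup>2 \<longleftrightarrow> norm z < sqrt (- u)" for z :: "real \<times> real"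
        using real_sqrt_less_iff[of "(norm z)\<^sup>2" "- u"] by auto
      with True show ?thesis
        by auto
    next
      case False
      have "\<not> u < - (norm z)\<^sup>2" for z :: "real \<times> real"
        using False zero_le_power2[of "norm z"] by linarith
      with False show ?thesis
        by auto
    qed
    also have "emeasure lborel \<dots> = (if u < 0 then ennreal (- u * pi) else 0)"
      by (simp add: emeasure_ball unit_ball_vol_2 mult.commute)
    finally show ?thesis .
  qed
  have N: "emeasure ?N {u<..} = (if u < 0 then ennreal (- u * pi) else 0)" for u
  proof -
    have "emeasure ?N {u<..} = (\<integral>\<^sup>+x. ennreal pi * indicator {u<..0} x \<partial>lborel)"
      by (auto simp: emeasure_density intro!: nn_integral_cong split: split_indicator)
    also have "\<dots> = ennreal pi * emeasure lborel {u<..0}"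
      by (simp add: nn_integral_cmult)
    finally show ?thesis
      by (auto simp: mult.commute simp flip: ennreal_mult)
  qed
  show "emeasure ?M {x<..} < \<infinity>" "emeasure ?M {x<..} = emeasure ?N {x<..}" for x
    by (simp_all add: M N)
qed simp_all

lemma radial_integral_plane:
  fixes h :: "real \<Rightarrow> 'b::{banach, second_countable_topology}"
  assumes [measurable]: "h \<in> borel_measurable borel"
    and nonneg: "\<And>r. r < 0 \<Longrightarrow> h r = 0"
    and int: "integrable lborel h"
  shows "integrable lborel (\<lambda>z::real\<times>real. h ((norm z)\<^sup>2))"
    and "(LINT z|(lborel :: (real \<times> real) measure). h ((norm z)\<^sup>2)) = pi *\<^sub>R (LINT r|lborel. h r)"
proof -
  have pt: "(pi * indicator {..0} u) *\<^sub>R h (- u) = pi *\<^sub>R h (- u)" for u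
    using nonneg[of "- u"] by (auto split: split_indicator)
  have refl: "(lborel :: real measure) = distr lborel borel uminus"
    by (simp add: lborel_distr_uminus)
  have int': "integrable lborel (\<lambda>u. h (- u))"
    using int by (subst (asm) refl) (simp add: integrable_distr_eq)
  have "integrable (density lborel (\<lambda>u. ennreal (pi * indicator {..0} u))) (\<lambda>u. h (- u))"
    using int' by (subst integrable_density) (auto simp: pt)
  then have "integrable (distr (lborel :: (real \<times> real) measure) borel (\<lambda>z. - (norm z)\<^sup>2)) (\<lambda>u. h (- u))"
    by (simp add: distr_norm_square_plane)
  then show "integrable lborel (\<lambda>z::real\<times>real. h ((norm z)\<^sup>2))"
    by (simp add: integrable_distr_eq)
  have "(LINT z|(lborel :: (real \<times> real) measure). h ((norm z)\<^sup>2)) =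
      (LINT u|distr (lborel :: (real \<times> real) measure) borel (\<lambda>z. - (norm z)\<^sup>2). h (- u))"
    by (simp add: integral_distr)
  also have "\<dots> = (LINT u|lborel. pi *\<^sub>R h (- u))"
    unfolding distr_norm_square_plane by (subst integral_density) (auto simp: pt)
  also have "\<dots> = pi *\<^sub>R (LINT u|lborel. h (- u))"
    by simp
  also have "(LINT u|lborel. h (- u)) = (LINT r|lborel. h r)"
    by (subst (2) refl) (simp add: integral_distr)
  finally show "(LINT z|(lborel :: (real \<times> real) measure). h ((norm z)\<^sup>2)) = pi *\<^sub>R (LINT r|lborel. h r)" .
qed

lemma lebesgue_integral_eq_integral_Icc:
  fixes g :: "real \<Rightarrow> 'b::euclidean_space"
  assumes "continuous_on {a..b} g" and "\<And>t. t \<notin> {a..b} \<Longrightarrow> g t = 0"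
  shows "integrable lborel g" "(LINT t|lborel. g t) = integral {a..b} g"
proof -
  have eq: "(\<lambda>t. indicator {a..b} t *\<^sub>R g t) = g"
    using assms(2) by (auto simp: fun_eq_iff indicator_def)
  have i: "set_integrable lborel {a..b} g"
    unfolding set_integrable_def by (rule borel_integrable_compact) (use assms in auto)
  then show "integrable lborel g"
    by (simp add: set_integrable_def eq)
  show "(LINT t|lborel. g t) = integral {a..b} g"
    using set_borel_integral_eq_integral(2)[OF i] by (simp add: set_lebesgue_integral_def eq)
qed

text \<open>
  By Fubini the left side is the integral of \<open>H'(p + \<bar>z\<bar>\<^sup>2)\<close> over the plane, hence
  \<open>\<pi> \<integral>\<^sub>0\<^sup>\<infinity> H'(p + r) dr\<close>.
\<close>
lemma abel_double_integral:
  fixes H :: "real \<Rightarrow> 'b::euclidean_space"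
  assumes deriv: "\<And>p. p \<ge> 0 \<Longrightarrow> (H has_vector_derivative H' p) (at p within {0..})"
    and cont: "continuous_on {0..} H'"
    and H0: "\<And>p. p \<ge> M \<Longrightarrow> H p = 0" and H'0: "\<And>p. p \<ge> M \<Longrightarrow> H' p = 0"
    and p: "p \<ge> 0"
  shows "(LINT s|lborel. LINT t|lborel. H' (p + s\<^sup>2 + t\<^sup>2)) = - pi *\<^sub>R H p"
proof -
  define N where "N = max M 0"
  \<comment> \<open>\<open>H'\<close> carries information on \<open>{0..}\<close> only; \<open>h\<close> extends the relevant part to an integrable function.\<close>
  define h where "h r = (if r \<in> {0..N} then H' (p + r) else 0)" for r
  have contN: "continuous_on {0..N} (\<lambda>r. H' (p + r))"
    by (rule continuous_on_compose2[OF cont]) (use p in \<open>auto intro: continuous_intros\<close>)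
  then have "continuous_on {0..N} h"
    by (rule continuous_on_eq) (simp add: h_def)
  note h = lebesgue_integral_eq_integral_Icc[OF this]
  have hint: "integrable lborel h"
    by (rule h) (auto simp: h_def)
  have hval: "h r = H' (p + r)" if "r \<ge> 0" for r
    using that p H'0[of "p + r"] by (auto simp: h_def N_def)
  have "((\<lambda>r. H' (p + r)) has_integral H (p + N) - H (p + 0)) {0..N}"
  proof (rule fundamental_theorem_of_calculus)
    fix r assume r: "r \<in> {0..N}"
    have "((\<lambda>r. p + r) has_vector_derivative 1) (at r within {0..N})"
      by (auto intro!: derivative_eq_intros)
    moreover have "(H has_vector_derivative H' (p + r)) (at (p + r) within (\<lambda>r. p + r) ` {0..N})"
      by (rule has_vector_derivative_within_subset[OF deriv]) (use p r in auto)
    ultimately show "((\<lambda>r. H (p + r)) has_vector_derivative H' (p + r)) (at r within {0..N})"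
      using vector_diff_chain_within by (fastforce simp: o_def)
  qed (simp add: N_def)
  then have "integral {0..N} (\<lambda>r. H' (p + r)) = - H p"
    using H0[of "p + N"] p by (auto simp: N_def dest!: integral_unique)
  also have "integral {0..N} (\<lambda>r. H' (p + r)) = integral {0..N} h"
    by (rule integral_cong) (simp add: h_def)
  also have "integral {0..N} h = (LINT r|lborel. h r)"
    by (rule h(2)[symmetric]) (auto simp: h_def)
  finally have int_h: "(LINT r|lborel. h r) = - H p" .
  have h_neg: "h r = 0" if "r < 0" for r
    using that by (simp add: h_def)
  have h_meas: "h \<in> borel_measurable borel"
    using borel_measurable_integrable[OF hint] by simp
  note planar = radial_integral_plane[OF h_meas h_neg hint]
  have "(LINT s|lborel. LINT t|lborel. H' (p + s\<^sup>2 + t\<^sup>2)) =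
      (LINT s|lborel. LINT t|lborel. h ((norm (s::real, t::real))\<^sup>2))"
    by (simp add: hval norm_prod_def add.assoc)
  also have "\<dots> = (LINT z::real \<times> real|(lborel \<Otimes>\<^sub>M lborel). h ((norm z)\<^sup>2))"
    by (rule lborel_pair.integral_fst'[of "\<lambda>z. h ((norm z)\<^sup>2)"])
       (use planar(1) in \<open>simp add: lborel_prod\<close>)
  also have "\<dots> = pi *\<^sub>R (LINT r|lborel. h r)"
    unfolding lborel_prod by (rule planar(2))
  finally show ?thesis
    by (simp add: int_h)
qed

text \<open>
  \<open>F(q) = -\<pi>\<^sup>-\<^sup>1 \<integral> H'(q + t\<^sup>2) dt\<close>. Since \<open>H'\<close> vanishes beyond \<open>L\<^sup>2\<close>, the integral only runs over
  \<open>[-L, L]\<close>, which keeps \<open>F\<close> smooth and makes it vanish beyond \<open>L\<^sup>2\<close>.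
\<close>
lemma abel_transform_onto:
  fixes H :: "real \<Rightarrow> 'b::euclidean_space"
  assumes H: "\<And>k. smooth_profile k {0..} H" and L: "L > 0" and H0: "\<And>p. p \<ge> L\<^sup>2 \<Longrightarrow> H p = 0"
  obtains F where "\<And>k. smooth_profile k {0..} F" and "\<And>q. q \<ge> L\<^sup>2 \<Longrightarrow> F q = 0"
    and "\<And>p. p \<ge> 0 \<Longrightarrow> (LINT s|lborel. F (p + s\<^sup>2)) = H p"
proof -
  have nontriv: "at p within {c..} \<noteq> bot" if "p \<in> {c..}" for p c :: real
    by (rule at_within_interval_neq_bot[of p "{c..}" "p + 1"]) (use that in \<open>auto simp: is_interval_ci\<close>)
  define H' where "H' p = vector_derivative H (at p within {0..})" for p
  have deriv: "(H has_vector_derivative H' p) (at p within {0..})" if "p \<in> {0..}" for p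
  proof -
    obtain G where "(H has_vector_derivative G p) (at p within {0..})"
      using smooth_profile_SucE[OF H[of "Suc 0"]] \<open>p \<in> {0..}\<close> by metis
    then show ?thesis
      unfolding H'_def by (metis vector_derivative_within nontriv[OF that])
  qed
  have H': "smooth_profile k {0..} H'" for k
    by (rule smooth_profile_derivative[OF H nontriv deriv])
  \<comment> \<open>At \<open>p = L\<^sup>2\<close> only the derivative from the right is known to be \<open>0\<close>, which determines \<open>H'\<close>.\<close>
  have H'0: "H' p = 0" if "p \<ge> L\<^sup>2" for p
  proof (rule vector_derivative_unique_within)
    show "at p within {p..} \<noteq> bot"
      by (rule nontriv) simp
    have "p \<ge> 0"
      using that zero_le_power2 order_trans by blast
    then show "(H has_vector_derivative H' p) (at p within {p..})"
      by (intro has_vector_derivative_within_subset[OF deriv]) auto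
    show "(H has_vector_derivative 0) (at p within {p..})"
      by (rule has_vector_derivative_transform[OF _ _ has_vector_derivative_const]) (use that H0 in auto)
  qed
  define F where "F q = (- 1 / pi) *\<^sub>R integral (cbox (-L) L) (\<lambda>t. H' (1 * q + t\<^sup>2))" for q
  show ?thesis
  proof
    show "smooth_profile k {0..} F" for k
      unfolding F_def
    proof (intro smooth_family_scaleR smooth_profile_integral)
      show "smooth_family k {0..} (cbox (-L) L) (\<lambda>q t. H' (1 * q + t\<^sup>2))"
        by (rule smooth_profile_affine[OF H']) (auto intro!: continuous_intros)
    qed (auto intro!: continuous_intros)
    show "F q = 0" if "q \<ge> L\<^sup>2" for q
    proof -
      have "H' (q + t\<^sup>2) = 0" for t
        by (rule H'0) (use that zero_le_power2[of t] in linarith)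
      then show ?thesis
        by (simp add: F_def)
    qed
    show "(LINT s|lborel. F (p + s\<^sup>2)) = H p" if p: "p \<ge> 0" for p
    proof -
      have F: "F q = (- 1 / pi) *\<^sub>R (LINT t|lborel. H' (q + t\<^sup>2))" if q: "q \<ge> 0" for q
      proof -
        have "continuous_on {-L..L} (\<lambda>t. H' (q + t\<^sup>2))"
          by (rule continuous_on_compose2[OF smooth_profile_continuous[OF H']])
             (use q in \<open>auto intro!: continuous_intros\<close>)
        moreover have "H' (q + t\<^sup>2) = 0" if "t \<notin> {-L..L}" for t
        proof (rule H'0)
          have "L\<^sup>2 \<le> t\<^sup>2"
            using that L by (intro abs_le_square_iff[THEN iffD1]) auto
          then show "L\<^sup>2 \<le> q + t\<^sup>2"
            using q by linarith
        qed
        ultimately show ?thesis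
          using lebesgue_integral_eq_integral_Icc(2)[of "-L" L "\<lambda>t. H' (q + t\<^sup>2)"]
          by (simp add: F_def)
      qed
      have "(LINT s|lborel. F (p + s\<^sup>2)) =
          (LINT s|lborel. (- 1 / pi) *\<^sub>R (LINT t|lborel. H' (p + s\<^sup>2 + t\<^sup>2)))"
        by (rule Bochner_Integration.integral_cong) (use p F in auto)
      also have "\<dots> = (- 1 / pi) *\<^sub>R (LINT s|lborel. LINT t|lborel. H' (p + s\<^sup>2 + t\<^sup>2))"
        by (rule integral_scaleR_right)
      also have "(LINT s|lborel. LINT t|lborel. H' (p + s\<^sup>2 + t\<^sup>2)) = - pi *\<^sub>R H p"
        by (rule abel_double_integral[where M = "L\<^sup>2"])
           (use deriv H0 H'0 p smooth_profile_continuous[OF H'] in auto)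
      finally show ?thesis
        by simp
    qed
  qed
qed

section \<open>The attenuated transform of radial functions\<close>

lemma norm_square_on_line:
  fixes x \<theta> :: "'a::real_inner"
  assumes "norm \<theta> = 1"
  shows "(norm (x + t *\<^sub>R \<theta>))\<^sup>2 = ((norm x)\<^sup>2 - (x \<bullet> \<theta>)\<^sup>2) + (t + x \<bullet> \<theta>)\<^sup>2"
proof -
  have "\<theta> \<bullet> \<theta> = 1"
    using assms by (simp add: norm_eq_1)
  then show ?thesis
    unfolding power2_norm_eq_inner
    by (simp add: inner_add_left inner_add_right inner_commute power2_eq_square algebra_simps)
qed

lemma beam_radial:
  assumes a: "\<And>x. a x = A ((norm x)\<^sup>2)" and \<theta>: "norm \<theta> = 1"
  shows "beam a (x + t *\<^sub>R \<theta>) \<theta> =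
    (LINT w:{0..}|lborel. A (((norm x)\<^sup>2 - (x \<bullet> \<theta>)\<^sup>2) + (t + x \<bullet> \<theta> + w)\<^sup>2))"
proof -
  have "(norm (x + t *\<^sub>R \<theta> + w *\<^sub>R \<theta>))\<^sup>2 = ((norm x)\<^sup>2 - (x \<bullet> \<theta>)\<^sup>2) + (t + x \<bullet> \<theta> + w)\<^sup>2" for w
    using norm_square_on_line[OF \<theta>, of x "t + w"] by (simp add: algebra_simps)
  then show ?thesis
    by (simp add: beam_def a)
qed

text \<open>
  The foot point of the line, at parameter \<open>-x \<bullet> \<theta>\<close>, becomes the origin of the integration variable.
\<close>
lemma att_xray_radial:
  fixes a f :: "real^2 \<Rightarrow> 'k::{real_normed_field, euclidean_space}"
  assumes a: "\<And>x. a x = A ((norm x)\<^sup>2)" and f: "\<And>x. f x = F ((norm x)\<^sup>2)" and \<theta>: "norm \<theta> = 1"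
    and p_def: "p = (norm x)\<^sup>2 - (x \<bullet> \<theta>)\<^sup>2"
  shows "att_xray a f x \<theta> =
    (LINT t|lborel. exp (- (LINT w:{0..}|lborel. A (p + (t + w)\<^sup>2))) * F (p + t\<^sup>2))"
proof -
  define g where "g t = exp (- (LINT w:{0..}|lborel. A (p + (t + w)\<^sup>2))) * F (p + t\<^sup>2)" for t
  have "att_xray a f x \<theta> = (LINT t|lborel. g (x \<bullet> \<theta> + 1 * t))"
    by (simp add: att_xray_def g_def p_def beam_radial[where a = a and A = A, OF a \<theta>] f norm_square_on_line[OF \<theta>] add.commute)
  also have "\<dots> = (LINT t|lborel. g t)"
    by (subst (2) lborel_integral_real_affine[where c = 1 and t = "x \<bullet> \<theta>"]) simp_all
  finally show ?thesis
    by (simp add: g_def p_def)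
qed

text \<open>
  All integrals can be cut off at distances depending only on \<open>L\<close>: \<open>F(p + t\<^sup>2)\<close> vanishes unless
  \<open>\<bar>t\<bar> < L\<close>, and for \<open>t \<ge> -L\<close> the attenuation \<open>A(p + (t + w)\<^sup>2)\<close> vanishes once \<open>w \<ge> 2 L\<close>. On these
  fixed compact intervals the integrals stay within the class of smooth families.
\<close>
lemma att_xray_profile:
  fixes A F :: "real \<Rightarrow> 'k::{real_normed_field, euclidean_space}"
  assumes A: "\<And>k. smooth_profile k {0..} A" and F: "\<And>k. smooth_profile k {0..} F"
    and L: "L > 0" and A0: "\<And>q. q \<ge> L\<^sup>2 \<Longrightarrow> A q = 0" and F0: "\<And>q. q \<ge> L\<^sup>2 \<Longrightarrow> F q = 0"
  obtains H where "\<And>k. smooth_profile k {0..} H" and "\<And>p. p \<ge> L\<^sup>2 \<Longrightarrow> H p = 0"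
    and "\<And>p. p \<ge> 0 \<Longrightarrow>
      (LINT t|lborel. exp (- (LINT w:{0..}|lborel. A (p + (t + w)\<^sup>2))) * F (p + t\<^sup>2)) = H p"
proof -
  \<comment> \<open>The coefficients \<open>1\<close> and \<open>- 1\<close> are kept for matching the closure properties.\<close>
  define \<beta> where "\<beta> p t = integral (cbox 0 (2 * L)) (\<lambda>w. A (1 * p + (t + w)\<^sup>2))" for p t
  define \<Phi> where "\<Phi> p t = exp (- 1 *\<^sub>R \<beta> p t) * F (1 * p + t\<^sup>2)" for p t
  have A_fam: "smooth_family k {0..} (cbox (-L) L \<times> cbox 0 (2 * L)) (\<lambda>p z. A (1 * p + (fst z + snd z)\<^sup>2))" for k
    by (rule smooth_profile_affine[OF A]) (auto intro!: continuous_intros)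
  have \<beta>: "smooth_family k {0..} (cbox (-L) L) \<beta>" for k
    unfolding \<beta>_def using smooth_family_integral[OF A_fam] by simp
  have F_fam: "smooth_family k {0..} (cbox (-L) L) (\<lambda>p t. F (1 * p + t\<^sup>2))" for k
    by (rule smooth_profile_affine[OF F]) (auto intro!: continuous_intros)
  have \<Phi>: "smooth_family k {0..} (cbox (-L) L) \<Phi>" for k
    unfolding \<Phi>_def
    by (intro smooth_family_mult smooth_family_exp smooth_family_scaleR[OF _ \<beta>] F_fam continuous_on_const)
  have out: "p + s\<^sup>2 \<ge> L\<^sup>2" if "p \<ge> 0" "\<bar>s\<bar> \<ge> L" for p s
    using that L abs_le_square_iff[of L s] by auto
  show ?thesis
  proof
    show "smooth_profile k {0..} (\<lambda>p. integral (cbox (-L) L) (\<Phi> p))" for k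
      by (rule smooth_profile_integral[OF \<Phi>]) simp
    show "integral (cbox (-L) L) (\<Phi> p) = 0" if "p \<ge> L\<^sup>2" for p
    proof -
      have "\<Phi> p = (\<lambda>_. 0)"
      proof
        fix t
        have "L\<^sup>2 \<le> p + t\<^sup>2"
          using that zero_le_power2[of t] by linarith
        then show "\<Phi> p t = 0"
          using F0[of "p + t\<^sup>2"] by (simp add: \<Phi>_def)
      qed
      then show ?thesis by simp
    qed
    fix p :: real assume p: "p \<ge> 0"
    have beam: "(LINT w:{0..}|lborel. A (p + (t + w)\<^sup>2)) = \<beta> p t" if t: "t \<ge> -L" for t
    proof -
      let ?g = "\<lambda>w. indicator {0..} w *\<^sub>R A (p + (t + w)\<^sup>2)"
      have c: "continuous_on {0..2 * L} (\<lambda>w. A (p + (t + w)\<^sup>2))"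
        by (rule continuous_on_compose2[OF smooth_profile_continuous[OF A]])
           (use p in \<open>auto intro!: continuous_intros\<close>)
      have "(LINT w:{0..}|lborel. A (p + (t + w)\<^sup>2)) = integral {0..2 * L} ?g"
        unfolding set_lebesgue_integral_def
      proof (rule lebesgue_integral_eq_integral_Icc)
        show "continuous_on {0..2 * L} ?g"
          by (rule continuous_on_eq[OF c]) auto
        show "?g w = 0" if "w \<notin> {0..2 * L}" for w
          using that t A0[OF out[OF p, of "t + w"]] by (auto simp: indicator_def)
      qed
      also have "\<dots> = \<beta> p t"
        unfolding \<beta>_def by (auto intro!: integral_cong)
      finally show ?thesis .
    qed
    let ?G = "\<lambda>t. exp (- (LINT w:{0..}|lborel. A (p + (t + w)\<^sup>2))) * F (p + t\<^sup>2)"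
    have eq: "?G t = \<Phi> p t" if "t \<in> {-L..L}" for t
      using that beam by (simp add: \<Phi>_def)
    have "(LINT t|lborel. ?G t) = integral {-L..L} ?G"
    proof (rule lebesgue_integral_eq_integral_Icc)
      have "continuous_on {-L..L} (\<lambda>t. (p, t))"
        by (intro continuous_intros)
      from continuous_on_compose2[OF smooth_family_continuous[OF \<Phi>] this]
      have "continuous_on {-L..L} (\<Phi> p)"
        using p by auto
      then show "continuous_on {-L..L} ?G"
        by (rule continuous_on_eq) (simp add: eq)
      show "?G t = 0" if "t \<notin> {-L..L}" for t
        using that F0[OF out[OF p, of t]] by auto
    qed
    also have "\<dots> = integral (cbox (-L) L) (\<Phi> p)"
      by (auto intro!: integral_cong eq)
    finally show "(LINT t|lborel. ?G t) = integral (cbox (-L) L) (\<Phi> p)" .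
  qed
qed

theorem theorem7p1:
  fixes a f :: "real^2 \<Rightarrow> 'k::{real_normed_field, euclidean_space}"
  assumes "smooth_compact_support a" and "radial a"
    and "smooth_compact_support f" and "radial f"
  shows "\<exists>f\<^sub>0 :: real^2 \<Rightarrow> 'k. smooth_compact_support f\<^sub>0 \<and>
           (\<forall>x. \<forall>\<theta> \<in> sphere 0 1. att_xray a f x \<theta> = att_xray (\<lambda>_. 0) f\<^sub>0 x \<theta>)"
proof -
  obtain A L\<^sub>1 where A: "\<And>k. smooth_profile k {0..} A" and aA: "\<And>x. a x = A ((norm x)\<^sup>2)"
    and L\<^sub>1: "L\<^sub>1 > 0" "\<And>q. q \<ge> L\<^sub>1\<^sup>2 \<Longrightarrow> A q = 0"
    using radial_profile[OF assms(1,2)] by blast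
  obtain F L\<^sub>2 where F: "\<And>k. smooth_profile k {0..} F" and fF: "\<And>x. f x = F ((norm x)\<^sup>2)"
    and L\<^sub>2: "L\<^sub>2 > 0" "\<And>q. q \<ge> L\<^sub>2\<^sup>2 \<Longrightarrow> F q = 0"
    using radial_profile[OF assms(3,4)] by blast
  define L where "L = max L\<^sub>1 L\<^sub>2"
  have L: "L > 0" "L\<^sub>1\<^sup>2 \<le> L\<^sup>2" "L\<^sub>2\<^sup>2 \<le> L\<^sup>2"
    using L\<^sub>1(1) L\<^sub>2(1) by (auto simp: L_def intro!: power_mono)
  have A0: "A q = 0" if "q \<ge> L\<^sup>2" for q
    using L(2) that by (intro L\<^sub>1(2)) simp
  have F0: "F q = 0" if "q \<ge> L\<^sup>2" for q
    using L(3) that by (intro L\<^sub>2(2)) simp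
  obtain H where H: "\<And>k. smooth_profile k {0..} H" "\<And>p. p \<ge> L\<^sup>2 \<Longrightarrow> H p = 0"
    "\<And>p. p \<ge> 0 \<Longrightarrow>
      (LINT t|lborel. exp (- (LINT w:{0..}|lborel. A (p + (t + w)\<^sup>2))) * F (p + t\<^sup>2)) = H p"
    using att_xray_profile[OF A F L(1) A0 F0] by blast
  obtain F\<^sub>0 where F\<^sub>0: "\<And>k. smooth_profile k {0..} F\<^sub>0" "\<And>q. q \<ge> L\<^sup>2 \<Longrightarrow> F\<^sub>0 q = 0"
    "\<And>p. p \<ge> 0 \<Longrightarrow> (LINT s|lborel. F\<^sub>0 (p + s\<^sup>2)) = H p"
    using abel_transform_onto[OF H(1) L(1) H(2)] by blast
  define f\<^sub>0 where "f\<^sub>0 x = F\<^sub>0 ((norm x)\<^sup>2)" for x :: "real^2"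
  have "smooth_compact_support f\<^sub>0"
    unfolding f\<^sub>0_def by (rule smooth_compact_support_norm_square[OF F\<^sub>0(1,2)])
  moreover have "att_xray a f x \<theta> = att_xray (\<lambda>_. 0) f\<^sub>0 x \<theta>" if "\<theta> \<in> sphere 0 1" for x \<theta>
  proof -
    define p where "p = (norm x)\<^sup>2 - (x \<bullet> \<theta>)\<^sup>2"
    have \<theta>: "norm \<theta> = 1"
      using that by simp
    have "\<bar>x \<bullet> \<theta>\<bar> \<le> norm x"
      using Cauchy_Schwarz_ineq2[of x \<theta>] \<theta> by simp
    then have p: "p \<ge> 0"
      unfolding p_def using abs_le_square_iff[of "x \<bullet> \<theta>" "norm x"] by simp
    have "att_xray a f x \<theta> = H p"
      using att_xray_radial[where a = a and A = A and f = f and F = F, OF aA fF \<theta> p_def] H(3)[OF p] by simp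
    also have "\<dots> = att_xray (\<lambda>_. 0) f\<^sub>0 x \<theta>"
      using att_xray_radial[of "\<lambda>_. 0" "\<lambda>_. 0" f\<^sub>0 F\<^sub>0, OF _ _ \<theta> p_def] F\<^sub>0(3)[OF p] f\<^sub>0_def
      by simp
    finally show ?thesis .
  qed
  ultimately show ?thesis
    by blast
qed

end
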